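(* Let $(X,p)$ be a TVS-cone metric space over a cone $P$ in a real Hausdorff locally convex topological vector space $E$, let $e\in\operatorname{int}P$, and let $(X,d_p)$ be its corresponding metric space, $d_p=\xi_e\circ p$. Assume $T:X\to X$ is a mapping such that $p(Tx,Ty)\le\varphi(p(x,y))$ for all $x,y\in X$, where $\varphi:P\to P$ is increasing and $\varphi(re)\le r\varphi(e)$ for every real number $r\ge 0$. Then there exists a linear, increasing and continuous mapping $\phi:\mathbb{R}^+\to\mathbb{R}^+$ such that $d_p(Tx,Ty)\le\phi(d_p(x,y))$ for all $x,y\in X$.
   Context: A cone is a non-empty subset $P\subset E$ with $P+P\subset P$, $\lambda P\subset P$ for all $\lambda\ge 0$, and $P\cap(-P)=\{0\}$; $P$ is always assumed closed with nonempty interior $\operatorname{int}P$. Write $x\le y$ iff $y-x\in P$, and $x\ll y$ iff $y-x\in\operatorname{int}P$. A TVS-cone metric space (TVS-CMS) $(X,p)$ over $P$ is a non-empty set $X$ with a map $p:X\times X\to E$ such that for all $x,y,z\in X$: $0\le p(x,y)$; $p(x,y)=0$ iff $x=y$; $p(x,y)=p(y,x)$; $p(x,y)\le p(x,z)+p(z,y)$. For $e\in\operatorname{int}P$ the nonlinear scalarization function $\xi_e:E\to\mathbb{R}$ is $\xi_e(y)=\inf\{t\in\mathbb{R}: y\in te-P\}$; it is known that $d_p=\xi_e\circ p:X\times X\to[0,\infty)$ is a metric on $X$. $\mathbb{R}^+=[0,\infty)$. "Increasing" means order-preserving ($u\le v$ implies $\varphi(u)\le\varphi(v)$). A linear map $\phi:\mathbb{R}^+\to\mathbb{R}^+$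 is one of the form $\phi(t)=at$ with a constant $a\ge 0$. *)

theory Defs
  imports "HOL-Analysis.Analysis"
begin

text \<open>
  Hausdorff locally convex real topological vector spaces. \<open>convex V\<close> is written out in
  \<open>locally_convex_0\<close>, because a class assumption cannot mention a constant whose type is already
  constrained to \<open>real_vector\<close>.
\<close>
class locally_convex_tvs = real_vector + topological_ab_group_add + t2_space +
  assumes tendsto_scaleR_Pair:
    "LIM x (nhds r \<times>\<^sub>F nhds a). fst x *\<^sub>R snd x :> nhds (r *\<^sub>R a)"
  assumes locally_convex_0:
    "open U \<Longrightarrow> 0 \<in> U \<Longrightarrow>
       \<exists>V. open V \<and> 0 \<in> V \<and> V \<subseteq> U \<and>
         (\<forall>x\<in>V. \<forall>y\<in>V. \<forall>u\<ge>0. \<forall>v\<ge>0. u + v = 1 \<longrightarrow> u *\<^sub>R x + v *\<^sub>R y \<in> V)"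

text \<open>
  Unlike the library's \<open>cone\<close> (closure under nonnegative scaling only), cones here are also
  additively closed, pointed, topologically closed, and have nonempty interior.
\<close>
definition order_cone :: "'e::locally_convex_tvs set \<Rightarrow> bool" where
  "order_cone P \<longleftrightarrow>
     P \<noteq> {} \<and> (\<forall>u\<in>P. \<forall>v\<in>P. u + v \<in> P) \<and> cone P \<and>
     P \<inter> uminus ` P = {0} \<and> closed P \<and> interior P \<noteq> {}"

definition cone_le :: "'e::locally_convex_tvs set \<Rightarrow> 'e \<Rightarrow> 'e \<Rightarrow> bool" where
  "cone_le P u v \<longleftrightarrow> v - u \<in> P"

definition tvs_cone_metric_space ::
    "'e::locally_convex_tvs set \<Rightarrow> 'x set \<Rightarrow> ('x \<Rightarrow> 'x \<Rightarrow> 'e) \<Rightarrow> bool" where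
  "tvs_cone_metric_space P X p \<longleftrightarrow>
     X \<noteq> {} \<and>
     (\<forall>x\<in>X. \<forall>y\<in>X. cone_le P 0 (p x y)) \<and>
     (\<forall>x\<in>X. \<forall>y\<in>X. p x y = 0 \<longleftrightarrow> x = y) \<and>
     (\<forall>x\<in>X. \<forall>y\<in>X. p x y = p y x) \<and>
     (\<forall>x\<in>X. \<forall>y\<in>X. \<forall>z\<in>X. cone_le P (p x y) (p x z + p z y))"

text \<open>
  If \<open>e\<close> lies in the interior of \<open>P\<close>, the set below is nonempty and bounded below, so \<open>Inf\<close> is the
  true infimum. The only exception is the zero space, where that set is all of \<open>\<real>\<close> and \<open>Inf\<close> has an
  unspecified value; a cone metric space over it has just one point.
\<close>
definition scalarization :: "'e::locally_convex_tvs set \<Rightarrow> 'e \<Rightarrow> 'e \<Rightarrow> real" where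
  "scalarization P e y = Inf {t. y \<in> (\<lambda>z. t *\<^sub>R e - z) ` P}"

definition scalarized_dist ::
    "'e::locally_convex_tvs set \<Rightarrow> 'e \<Rightarrow> ('x \<Rightarrow> 'x \<Rightarrow> 'e) \<Rightarrow> 'x \<Rightarrow> 'x \<Rightarrow> real" where
  "scalarized_dist P e p x y = scalarization P e (p x y)"

end

theory Submission
  imports Defs
begin

text \<open>
  Write \<open>\<xi>\<close> for the scalarization function. If \<open>e \<noteq> 0\<close>, the infimum defining \<open>\<xi> y\<close> is attained:
  the admissible \<open>t\<close> form a closed set because \<open>P\<close> is closed, a nonempty one because \<open>e\<close> absorbs
  every vector, and one bounded below because \<open>P\<close> is pointed. Hence \<open>\<xi> y \<le> t\<close> is the same as
  \<open>y \<le> t e\<close> in the cone order (\<open>scalarization_le_iff\<close>), and real inequalities between values of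
  \<open>\<xi>\<close> are read off from cone inequalities. With \<open>r = \<xi> (p x y)\<close> and \<open>a = \<xi> (\<phi> e)\<close>,
  the cone order gives \<open>p (T x) (T y) \<le> \<phi> (p x y) \<le> \<phi> (r e) \<le> r (\<phi> e) \<le> r a e\<close>,
  so \<open>\<xi> (p (T x) (T y)) \<le> a r\<close>, and \<open>t \<mapsto> a t\<close> is the required map.

  If \<open>e = 0\<close>, absorption makes \<open>P\<close> the whole space, so every real \<open>t\<close> is admissible: \<open>\<xi>\<close> is a
  constant, and the identity is the required map.
\<close>

lemma locally_convex_tendsto_scaleR:
  fixes g :: "'b \<Rightarrow> 'e::locally_convex_tvs"
  assumes "(f \<longlongrightarrow> r) F" and "(g \<longlongrightarrow> a) F"
  shows "((\<lambda>x. f x *\<^sub>R g x) \<longlongrightarrow> r *\<^sub>R a) F"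
  using filterlim_compose[OF tendsto_scaleR_Pair filterlim_Pair[OF assms]] by simp

lemma scalarization_alt:
  "scalarization P e y = Inf {t. cone_le P y (t *\<^sub>R e)}"
proof -
  have "y \<in> (\<lambda>z. t *\<^sub>R e - z) ` P \<longleftrightarrow> cone_le P y (t *\<^sub>R e)" for t
    unfolding cone_le_def
  proof
    assume "t *\<^sub>R e - y \<in> P"
    then show "y \<in> (\<lambda>z. t *\<^sub>R e - z) ` P"
      by (intro image_eqI[of _ _ "t *\<^sub>R e - y"]) simp_all
  qed auto
  then show ?thesis by (simp add: scalarization_def)
qed

lemma order_cone_add: "order_cone P \<Longrightarrow> u \<in> P \<Longrightarrow> v \<in> P \<Longrightarrow> u + v \<in> P"
  by (simp add: order_cone_def)

lemma order_cone_scaleR: "order_cone P \<Longrightarrow> u \<in> P \<Longrightarrow> 0 \<le> c \<Longrightarrow> c *\<^sub>R u \<in> P"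
  by (simp add: order_cone_def cone_def)

lemma order_cone_closed: "order_cone P \<Longrightarrow> closed P"
  by (simp add: order_cone_def)

lemma order_cone_pointed: "order_cone P \<Longrightarrow> u \<in> P \<Longrightarrow> - u \<in> P \<Longrightarrow> u = 0"
  unfolding order_cone_def by force

lemma cone_le_trans:
  assumes "order_cone P" and "cone_le P u v" and "cone_le P v w"
  shows "cone_le P u w"
  using order_cone_add[OF assms(1), of "v - u" "w - v"] assms(2,3)
  by (simp add: cone_le_def)

lemma cone_le_scaleR_left:
  assumes "order_cone P" and "cone_le P u v" and "0 \<le> c"
  shows "cone_le P (c *\<^sub>R u) (c *\<^sub>R v)"
  using order_cone_scaleR[OF assms(1), of "v - u" c] assms(2,3)
  by (simp add: cone_le_def scaleR_diff_right)

lemma cone_le_scaleR_right: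
  assumes "order_cone P" and "u \<in> P" and "s \<le> t"
  shows "cone_le P (s *\<^sub>R u) (t *\<^sub>R u)"
  using order_cone_scaleR[OF assms(1,2), of "t - s"] assms(3)
  by (simp add: cone_le_def scaleR_diff_left)

text \<open>
  An interior point is an order unit: \<open>e - s y \<longlongrightarrow> e\<close> as \<open>s \<longlongrightarrow> 0\<close>, so \<open>e - s y\<close> lies in \<open>P\<close> for some
  \<open>s > 0\<close>, and dividing by \<open>s\<close> gives a multiple of \<open>e\<close> above \<open>y\<close>.
\<close>
lemma interior_order_unit:
  assumes P: "order_cone P" and e: "e \<in> interior P"
  obtains t where "cone_le P y (t *\<^sub>R e)"
proof -
  have "((\<lambda>s::real. e - s *\<^sub>R y) \<longlongrightarrow> e - 0 *\<^sub>R y) (at_right 0)"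
    by (intro tendsto_diff tendsto_const locally_convex_tendsto_scaleR tendsto_ident_at)
  then have "eventually (\<lambda>s. e - s *\<^sub>R y \<in> interior P) (at_right (0::real))"
    using e by (intro topological_tendstoD) auto
  then have "eventually (\<lambda>s. e - s *\<^sub>R y \<in> interior P \<and> 0 < s) (at_right (0::real))"
    using eventually_at_right_less[of "0::real"] by (rule eventually_conj)
  then obtain s :: real where s: "e - s *\<^sub>R y \<in> P" "0 < s"
    using eventually_happens'[OF trivial_limit_at_right_real] interior_subset by blast
  have "(1 / s) *\<^sub>R (e - s *\<^sub>R y) \<in> P"
    using s by (intro order_cone_scaleR[OF P]) auto
  then have "cone_le P y ((1 / s) *\<^sub>R e)"
    using s(2) by (simp add: cone_le_def scaleR_diff_right)
  then show ?thesis by (rule that)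
qed

text \<open>
  Pointedness excludes negative multiples: scaling one of them back would put \<open>- e\<close> into \<open>P\<close>.
\<close>
lemma order_cone_scaleR_nonneg:
  assumes P: "order_cone P" and "e \<in> P" and "e \<noteq> 0" and t: "t *\<^sub>R e \<in> P"
  shows "0 \<le> t"
proof (rule ccontr)
  assume "\<not> 0 \<le> t"
  then have "t < 0" by simp
  then have "(1 / - t) *\<^sub>R (t *\<^sub>R e) \<in> P"
    by (intro order_cone_scaleR[OF P t]) simp
  then have "- e \<in> P" using \<open>t < 0\<close> by simp
  with assms order_cone_pointed[OF P] show False by blast
qed

text \<open>
  The order unit property applied to \<open>- y\<close> gives \<open>t\<^sub>0\<close> with \<open>- y \<le> t\<^sub>0 e\<close>; adding this to \<open>y \<le> t e\<close>
  shows \<open>(t + t\<^sub>0) e \<in> P\<close>, so every admissible \<open>t\<close> is at least \<open>- t\<^sub>0\<close>.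
\<close>
lemma scalarization_bdd_below:
  assumes P: "order_cone P" and e: "e \<in> interior P" and "e \<noteq> 0"
  shows "bdd_below {t. cone_le P y (t *\<^sub>R e)}"
proof -
  obtain t0 where t0: "cone_le P (- y) (t0 *\<^sub>R e)"
    using interior_order_unit[OF P e] .
  have "- t0 \<le> t" if t: "cone_le P y (t *\<^sub>R e)" for t
  proof -
    have "(t + t0) *\<^sub>R e \<in> P"
      using order_cone_add[OF P, of "t *\<^sub>R e - y" "t0 *\<^sub>R e + y"] t t0
      by (simp add: cone_le_def scaleR_add_left)
    then have "0 \<le> t + t0"
      using order_cone_scaleR_nonneg[OF P] e interior_subset \<open>e \<noteq> 0\<close> by blast
    then show ?thesis by simp
  qed
  then show ?thesis by (intro bdd_belowI[of _ "- t0"]) auto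
qed

lemma scalarization_attained:
  assumes P: "order_cone P" and e: "e \<in> interior P" and "e \<noteq> 0"
  shows "cone_le P y (scalarization P e y *\<^sub>R e)"
proof -
  let ?S = "{t. cone_le P y (t *\<^sub>R e)}"
  have "continuous_on UNIV (\<lambda>t::real. t *\<^sub>R e - y)"
    unfolding continuous_on_def
    by (intro ballI tendsto_diff locally_convex_tendsto_scaleR tendsto_ident_at tendsto_const)
  then have "closed ((\<lambda>t::real. t *\<^sub>R e - y) -` P)"
    using order_cone_closed[OF P] by (simp add: closed_vimage)
  then have "closed ?S" by (simp add: vimage_def cone_le_def)
  moreover have "?S \<noteq> {}"
    using interior_order_unit[OF P e, of y] by blast
  ultimately have "Inf ?S \<in> ?S"
    by (intro closed_contains_Inf scalarization_bdd_below[OF assms])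
  then show ?thesis by (simp add: scalarization_alt)
qed

text \<open>
  The Galois connection between \<open>\<xi>\<close> and \<open>t \<mapsto> t e\<close>. The forward direction needs the infimum to be
  attained.
\<close>
lemma scalarization_le_iff:
  assumes P: "order_cone P" and e: "e \<in> interior P" and "e \<noteq> 0"
  shows "scalarization P e y \<le> t \<longleftrightarrow> cone_le P y (t *\<^sub>R e)"
proof
  assume "scalarization P e y \<le> t"
  moreover have "e \<in> P" using e interior_subset by blast
  ultimately show "cone_le P y (t *\<^sub>R e)"
    using cone_le_trans[OF P scalarization_attained[OF assms]] cone_le_scaleR_right[OF P]
    by blast
next
  assume "cone_le P y (t *\<^sub>R e)"
  then show "scalarization P e y \<le> t"
    using scalarization_bdd_below[OF assms] by (simp add: scalarization_alt cInf_lower)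
qed

lemma scalarization_nonneg:
  assumes P: "order_cone P" and e: "e \<in> interior P" and "e \<noteq> 0" and "y \<in> P"
  shows "0 \<le> scalarization P e y"
proof -
  have "cone_le P 0 y" using \<open>y \<in> P\<close> by (simp add: cone_le_def)
  then have "cone_le P 0 (scalarization P e y *\<^sub>R e)"
    by (rule cone_le_trans[OF P _ scalarization_attained[OF P e \<open>e \<noteq> 0\<close>]])
  then have "scalarization P e y *\<^sub>R e \<in> P" by (simp add: cone_le_def)
  moreover have "e \<in> P" using e interior_subset by blast
  ultimately show ?thesis using order_cone_scaleR_nonneg[OF P] \<open>e \<noteq> 0\<close> by blast
qed

text \<open>
  The Lipschitz estimate for a single pair of points: \<open>y\<close> stands for \<open>p x y\<close> and \<open>z\<close> for \<open>p (T x) (T y)\<close>.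
\<close>
lemma scalarization_le_mult:
  assumes P: "order_cone P" and e: "e \<in> interior P" and ne: "e \<noteq> 0"
    and mono: "\<forall>u\<in>P. \<forall>v\<in>P. cone_le P u v \<longrightarrow> cone_le P (\<phi> u) (\<phi> v)"
    and sub: "\<forall>r\<ge>0. cone_le P (\<phi> (r *\<^sub>R e)) (r *\<^sub>R \<phi> e)"
    and y: "y \<in> P" and z: "cone_le P z (\<phi> y)"
  shows "scalarization P e z \<le> scalarization P e (\<phi> e) * scalarization P e y"
proof -
  let ?r = "scalarization P e y" and ?a = "scalarization P e (\<phi> e)"
  have r: "0 \<le> ?r" by (rule scalarization_nonneg[OF P e ne y])
  have "e \<in> P" using e interior_subset by blast
  then have "?r *\<^sub>R e \<in> P" using r order_cone_scaleR[OF P] by blast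
  then have "cone_le P (\<phi> y) (\<phi> (?r *\<^sub>R e))"
    using mono y scalarization_attained[OF P e ne] by blast
  with z have "cone_le P z (\<phi> (?r *\<^sub>R e))" by (rule cone_le_trans[OF P])
  moreover have "cone_le P (\<phi> (?r *\<^sub>R e)) (?r *\<^sub>R \<phi> e)" using sub r by blast
  ultimately have "cone_le P z (?r *\<^sub>R \<phi> e)" by (rule cone_le_trans[OF P])
  moreover have "cone_le P (?r *\<^sub>R \<phi> e) (?r *\<^sub>R (?a *\<^sub>R e))"
    by (rule cone_le_scaleR_left[OF P scalarization_attained[OF P e ne] r])
  ultimately have "cone_le P z (?r *\<^sub>R (?a *\<^sub>R e))" by (rule cone_le_trans[OF P])
  then show ?thesis by (simp add: scalarization_le_iff[OF P e ne] mult.commute)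
qed

theorem theorem30:
  fixes P :: "'e::locally_convex_tvs set" and e :: 'e
    and X :: "'x set" and p :: "'x \<Rightarrow> 'x \<Rightarrow> 'e"
    and T :: "'x \<Rightarrow> 'x" and \<phi> :: "'e \<Rightarrow> 'e"
  assumes "order_cone P"
    and "e \<in> interior P"
    and "tvs_cone_metric_space P X p"
    and "T \<in> X \<rightarrow> X"
    and "\<phi> \<in> P \<rightarrow> P"
    and "\<forall>u\<in>P. \<forall>v\<in>P. cone_le P u v \<longrightarrow> cone_le P (\<phi> u) (\<phi> v)"
    and "\<forall>r\<ge>0. cone_le P (\<phi> (r *\<^sub>R e)) (r *\<^sub>R \<phi> e)"
    and "\<forall>x\<in>X. \<forall>y\<in>X. cone_le P (p (T x) (T y)) (\<phi> (p x y))"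
  shows "\<exists>\<psi>::real \<Rightarrow> real.
           \<psi> \<in> {0..} \<rightarrow> {0..} \<and>
           (\<exists>a\<ge>0. \<forall>t\<ge>0. \<psi> t = a * t) \<and>
           mono_on {0..} \<psi> \<and>
           continuous_on {0..} \<psi> \<and>
           (\<forall>x\<in>X. \<forall>y\<in>X.
              scalarized_dist P e p (T x) (T y) \<le> \<psi> (scalarized_dist P e p x y))"
proof -
  note P = assms(1) and e = assms(2)
  have "\<exists>a\<ge>0. \<forall>x\<in>X. \<forall>y\<in>X.
      scalarized_dist P e p (T x) (T y) \<le> a * scalarized_dist P e p x y"
  proof (cases "e = 0")
    case True
    have "P = UNIV"
    proof -
      have "y \<in> P" for y
        using interior_order_unit[OF P e, of "- y"] True by (auto simp: cone_le_def)
      then show ?thesis by blast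
    qed
    then have "scalarization P e u = Inf UNIV" for u
      by (simp add: scalarization_alt cone_le_def)
    then show ?thesis by (intro exI[of _ 1]) (simp add: scalarized_dist_def)
  next
    case ne: False
    have "e \<in> P" using e interior_subset by blast
    then have "0 \<le> scalarization P e (\<phi> e)"
      using assms(5) by (intro scalarization_nonneg[OF P e ne]) auto
    moreover have "p x y \<in> P" if "x \<in> X" "y \<in> X" for x y
      using assms(3) that by (simp add: tvs_cone_metric_space_def cone_le_def)
    ultimately show ?thesis
      using scalarization_le_mult[OF P e ne assms(6,7)] assms(8)
      unfolding scalarized_dist_def by blast
  qed
  then obtain a where a: "0 \<le> a"
    "\<forall>x\<in>X. \<forall>y\<in>X. scalarized_dist P e p (T x) (T y) \<le> a * scalarized_dist P e p x y"
    by blast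
  moreover have "mono_on {0..} (\<lambda>t. a * t)"
    using a(1) by (intro mono_onI mult_left_mono)
  moreover have "continuous_on {0..} (\<lambda>t. a * t)"
    by (intro continuous_intros)
  ultimately show ?thesis
    by (intro exI[of _ "\<lambda>t. a * t"]) auto
qed

end
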